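(* Let $D\subset\mathbb C^n$ be a bounded convex domain and let $f:\mathbb D\to D$ be a complex geodesic with two left inverses $G_0$ and $G_1$. Let $H_0$ and $H_1$ be the Lempert left inverses to $f$ corresponding to $G_0$ and $G_1$, respectively. Then there is a one-parameter family of Lempert left inverses $H_t:D\to\mathbb D$, $t\in[0,1]$, to the complex geodesic $f$ connecting $H_0$ and $H_1$, i.e. such that $(t,z)\mapsto H_t(z)$ is continuous on $[0,1]\times D$ and $H_t$ equals the given $H_0$, $H_1$ for $t=0$, $t=1$.
   Context: $\mathbb D$ is the open unit disc in $\mathbb C$. For $w,z\in\mathbb C^n$, $w\bullet z:=\sum_{j=1}^n w_jz_j$. For a holomorphic function $G$ on $D$, $G'(z)=(\partial G/\partial z_1(z),\ldots,\partial G/\partial z_n(z))$. A holomorphic map $f:\mathbb D\to D$ is a complex geodesic if there is a holomorphic function $G:D\to\mathbb D$ with $G(f(\lambda))=\lambda$ for all $\lambda\in\mathbb D$; any such $G$ is called a left inverse to $f$. A left inverse $G$ is called a Lempert left inverse if for every $\lambda\in\mathbb D$ the fiber $G^{-1}(\lambda)$ is the intersection of $D$ with a complex affine hyperplane of $\mathbb C^n$. The Lempert left inverse $H$ corresponding to a left inverse $G$ of $f$ (in a bounded convex domain $D$) is defined as follows: for each $z\in D$, $H(z)$ is the unique $\lambda\in\mathbb D$ with $(z-f(\lambda))\bullet G'(f(\lambda))=0$. It is a fact that this $\lambda$ exists and is unique, and that $H$ is a (holomorphic) Lempert left inverse to $f$ with $H'(f(\lambda))=G'(f(\lambda))$ for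 $\lambda\in\mathbb D$. *)

theory Defs
  imports "HOL-Complex_Analysis.Complex_Analysis"
begin

text \<open>
  The space of \<open>n\<close>-tuples of complex numbers is \<open>complex ^ 'n\<close>. The bilinear (not Hermitian) product
  of \<open>w\<close> and \<open>z\<close> is the library's \<^const>\<open>scalar_product\<close>, whereas \<open>(\<bullet>)\<close> on this type is the real
  inner product. All domains below are open sets.
\<close>

abbreviation unit_disc :: "complex set" where
  "unit_disc \<equiv> ball 0 1"

text \<open>
  Complex differentiability at every point of \<open>D\<close>: the real Frechet derivative exists and is
  complex linear, i.e. of the form \<open>v \<mapsto> a\<^sub>1 v\<^sub>1 + \<dots> + a\<^sub>n v\<^sub>n\<close>.
\<close>

definition holomorphic_fun_on :: "(complex ^ 'n \<Rightarrow> complex) \<Rightarrow> (complex ^ 'n) set \<Rightarrow> bool" where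
  "holomorphic_fun_on G D \<longleftrightarrow> (\<forall>z\<in>D. \<exists>a. (G has_derivative scalar_product a) (at z))"

definition holomorphic_curve_on :: "(complex \<Rightarrow> complex ^ 'n) \<Rightarrow> complex set \<Rightarrow> bool" where
  "holomorphic_curve_on f S \<longleftrightarrow> (\<forall>j. (\<lambda>\<zeta>. f \<zeta> $ j) holomorphic_on S)"

text \<open>The vector of partial derivatives with respect to the coordinates.\<close>

definition complex_gradient :: "(complex ^ 'n \<Rightarrow> complex) \<Rightarrow> complex ^ 'n \<Rightarrow> complex ^ 'n" where
  "complex_gradient G z = (\<chi> j. deriv (\<lambda>w. G (\<chi> k. if k = j then w else z $ k)) (z $ j))"

text \<open>Total functions represent maps on \<open>D\<close>; their values outside \<open>D\<close> are irrelevant.\<close>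

definition left_inverse ::
    "(complex ^ 'n) set \<Rightarrow> (complex \<Rightarrow> complex ^ 'n) \<Rightarrow> (complex ^ 'n \<Rightarrow> complex) \<Rightarrow> bool" where
  "left_inverse D f G \<longleftrightarrow>
     holomorphic_fun_on G D \<and> G ` D \<subseteq> unit_disc \<and> (\<forall>\<zeta>\<in>unit_disc. G (f \<zeta>) = \<zeta>)"

definition complex_geodesic :: "(complex ^ 'n) set \<Rightarrow> (complex \<Rightarrow> complex ^ 'n) \<Rightarrow> bool" where
  "complex_geodesic D f \<longleftrightarrow>
     holomorphic_curve_on f unit_disc \<and> f ` unit_disc \<subseteq> D \<and> (\<exists>G. left_inverse D f G)"

definition complex_affine_hyperplane :: "(complex ^ 'n) set \<Rightarrow> bool" where
  "complex_affine_hyperplane P \<longleftrightarrow> (\<exists>a b. a \<noteq> 0 \<and> P = {z. scalar_product a z = b})"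

definition lempert_left_inverse ::
    "(complex ^ 'n) set \<Rightarrow> (complex \<Rightarrow> complex ^ 'n) \<Rightarrow> (complex ^ 'n \<Rightarrow> complex) \<Rightarrow> bool" where
  "lempert_left_inverse D f G \<longleftrightarrow>
     left_inverse D f G \<and>
     (\<forall>\<zeta>\<in>unit_disc. \<exists>P. complex_affine_hyperplane P \<and> {z \<in> D. G z = \<zeta>} = D \<inter> P)"

text \<open>
  The Lempert left inverse corresponding to a left inverse \<open>G\<close> of \<open>f\<close>. For a bounded convex domain
  \<open>D\<close> and \<open>z \<in> D\<close>, the defining equation has exactly one solution in the disc; for other \<open>z\<close> the
  value is unspecified.
\<close>

definition corresponding_lempert ::
    "(complex \<Rightarrow> complex ^ 'n) \<Rightarrow> (complex ^ 'n \<Rightarrow> complex) \<Rightarrow> complex ^ 'n \<Rightarrow> complex" where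
  "corresponding_lempert f G z =
     (THE \<zeta>. \<zeta> \<in> unit_disc \<and> scalar_product (z - f \<zeta>) (complex_gradient G (f \<zeta>)) = 0)"

end

theory Submission
  imports Defs
begin

text \<open>
  Write \<open>h \<zeta>\<close> for the gradient of a left inverse \<open>G\<close> at \<open>f \<zeta>\<close> and \<open>\<Phi> z \<zeta>\<close> for the product of
  \<open>z - f \<zeta>\<close> with \<open>h \<zeta>\<close>, whose zero in the disc is the value at \<open>z\<close> of the corresponding Lempert left
  inverse. Convex combinations \<open>G\<^sub>t\<close> of \<open>G\<^sub>0\<close> and \<open>G\<^sub>1\<close> are again left inverses of \<open>f\<close>, and the form
  \<open>\<Phi>\<close> depends affinely on \<open>t\<close>. The family sought consists of the Lempert left inverses that
  correspond to the \<open>G\<^sub>t\<close>. What has to be shown is that the zero of \<open>\<Phi> z\<close> exists, is unique, stays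
  away from the unit circle locally uniformly in \<open>t\<close> and \<open>z\<close>, and depends holomorphically on \<open>z\<close>.

  The holomorphic self-maps \<open>g\<^sub>s \<zeta> = G (f \<zeta> + s (z - f \<zeta>))\<close> of the disc start at the identity for
  \<open>s = 0\<close> with velocity \<open>\<Phi> z\<close>. Hence \<open>\<Phi> z\<close> is an infinitesimal contraction of the hyperbolic metric;
  differentiating the Schwarz-Pick inequality for two points on one radius shows that its outward
  component measured in hyperbolic length, \<open>Re (\<Phi> z \<zeta> cnj e) / (1 - r\<^sup>2)\<close> at \<open>\<zeta> = r e\<close>, does not
  increase with \<open>r\<close> (lemma \<open>radial_monotonicity\<close>).

  Because \<open>z\<close> is an interior point of the bounded set \<open>D\<close>, the monotonicity may also be used at the
  point \<open>z + \<epsilon> (z - f a)\<close> with one \<open>\<epsilon> > 0\<close> for all \<open>a\<close> in the disc. This point makes \<open>\<Phi> z\<close> a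
  proper convex combination of two contractions, one of which is \<open>\<Phi> (f a)\<close>; the latter vanishes at \<open>a\<close>
  with derivative \<open>-1\<close>. Taking for \<open>a\<close> the point under consideration, the outward component decreases
  at least at the rate \<open>\<epsilon> / (1 + \<epsilon>)\<close> per unit of hyperbolic length (lemma \<open>radial_decay\<close>). Since the
  radius has infinite length, \<open>\<Phi> z\<close> points inward near the whole unit circle, with bounds that
  depend only on \<open>\<epsilon>\<close> and on a bound for \<open>\<Phi> z 0\<close>.

  A field that points inward near the circle has exactly one zero, and a simple one, by the maximum
  principle for real parts (lemma \<open>inward_field_has_unique_simple_zero\<close>). As the zeros stay in a
  compact subset of the disc, their joint continuity in \<open>(t, z)\<close> follows from the closed graph
  criterion. Holomorphy in \<open>z\<close> follows from simplicity because \<open>\<Phi>\<close> is affine in \<open>z\<close>, and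
  the fiber over \<open>\<zeta>\<close> is the slice of \<open>D\<close> by the hyperplane \<open>\<Phi> z \<zeta> = 0\<close>.
\<close>

section \<open>Inward pointing holomorphic fields on the disc\<close>

lemma Re_negative_in_disc:
  assumes "g holomorphic_on cball 0 R" and "0 < R"
    and "\<And>z. cmod z = R \<Longrightarrow> Re (g z) < 0" and "cmod z \<le> R"
  shows "Re (g z) < 0"
proof -
  have cont: "continuous_on (cball 0 R) g"
    using assms(1) by (rule holomorphic_on_imp_continuous_on)
  have "continuous_on (sphere 0 R) (\<lambda>z. Re (g z))"
    by (intro continuous_intros continuous_on_subset[OF cont]) auto
  moreover have "sphere (0::complex) R \<noteq> {}"
    using \<open>0 < R\<close> by simp
  ultimately obtain m where m: "m \<in> sphere 0 R" "\<forall>z\<in>sphere 0 R. Re (g z) \<le> Re (g m)"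
    using continuous_attains_sup[of "sphere 0 R" "\<lambda>z. Re (g z)"] by auto
  have "Re (g z) \<le> Re (g m)"
  proof (rule maximum_real_frontier[of g "cball 0 R"])
    show "g holomorphic_on interior (cball 0 R)"
      using assms(1) by (rule holomorphic_on_subset) auto
  qed (use cont m assms(4) \<open>0 < R\<close> in auto)
  also have "\<dots> < 0"
    using assms(3) m(1) by simp
  finally show ?thesis .
qed

text \<open>
  If \<open>\<phi>\<close> had no zero, \<open>z / \<phi> z\<close> would be holomorphic with negative real part on a circle, contradicting
  its value \<open>0\<close> at the centre. Once a zero \<open>a\<close> is found, dividing \<open>\<phi>\<close> by \<open>z - a\<close> and by the reflected
  factor \<open>R\<^sup>2 - cnj a * z\<close> gives a function whose real part is again negative on \<open>\<bar>z\<bar> = R\<close>, since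
  \<open>(z - a) * (R\<^sup>2 - cnj a * z) = z * \<bar>z - a\<bar>\<^sup>2\<close> there. Its real part is then negative inside as well,
  which excludes further zeros and a double zero at \<open>a\<close>.
\<close>

lemma inward_field_has_unique_simple_zero:
  assumes holo: "\<phi> holomorphic_on unit_disc" and R0: "0 \<le> R0" "R0 < 1"
    and inward: "\<And>z. \<lbrakk>R0 < cmod z; cmod z < 1\<rbrakk> \<Longrightarrow> Re (\<phi> z * cnj z) < 0"
  obtains a \<psi> where "cmod a \<le> R0" and "\<psi> holomorphic_on unit_disc"
    and "\<And>z. z \<in> unit_disc \<Longrightarrow> \<psi> z \<noteq> 0" and "\<And>z. z \<in> unit_disc \<Longrightarrow> \<phi> z = (z - a) * \<psi> z"
proof -
  have "\<exists>a\<in>unit_disc. \<phi> a = 0"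
  proof (rule ccontr)
    assume "\<not> ?thesis"
    then have nz: "\<phi> z \<noteq> 0" if "cmod z < 1" for z
      using that by simp
    define R where "R = (1 + R0) / 2"
    have R: "0 < R" "R0 < R" "R < 1"
      using R0 by (auto simp: R_def)
    have "Re (0 / \<phi> 0) < 0"
    proof (rule Re_negative_in_disc[of "\<lambda>z. z / \<phi> z" R 0])
      have "cball 0 R \<subseteq> unit_disc"
        using R by auto
      then show "(\<lambda>z. z / \<phi> z) holomorphic_on cball 0 R"
        using nz R(3) by (intro holomorphic_intros holomorphic_on_subset[OF holo]) auto
      fix z :: complex
      assume z: "cmod z = R"
      then have "Re (\<phi> z * cnj z) < 0"
        using inward R by simp
      moreover have "z / \<phi> z = z * cnj (\<phi> z) / of_real ((cmod (\<phi> z))\<^sup>2)"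
        by (rule complex_div_cnj[of z "\<phi> z", folded of_real_power])
      moreover have "Re (z * cnj (\<phi> z)) = Re (\<phi> z * cnj z)"
        by (simp add: algebra_simps)
      moreover have "0 < (cmod (\<phi> z))\<^sup>2"
        using nz[of z] z R by simp
      ultimately show "Re (z / \<phi> z) < 0"
        by (simp only: Re_divide_of_real divide_less_0_iff) auto
    qed (use R in auto)
    then show False
      by simp
  qed
  then obtain a where a: "cmod a < 1" "\<phi> a = 0"
    by auto
  have aR0: "cmod a \<le> R0"
    using inward[of a] a by (cases "R0 < cmod a") auto
  define \<psi> where "\<psi> z = (if z = a then deriv \<phi> a else (\<phi> z - \<phi> a) / (z - a))" for z
  have holo_psi: "\<psi> holomorphic_on unit_disc"
    unfolding \<psi>_def by (rule pole_lemma_open[OF holo]) simp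
  have fact: "\<phi> z = (z - a) * \<psi> z" for z
    using a(2) by (simp add: \<psi>_def)
  have "\<psi> z \<noteq> 0" if z: "z \<in> unit_disc" for z
  proof -
    \<comment> \<open>The circle has to enclose \<open>z\<close> and to lie where the field points inward.\<close>
    define R where "R = (1 + max R0 (cmod z)) / 2"
    have R: "0 < R" "R0 < R" "R < 1" "cmod z < R"
      using R0 z by (auto simp: R_def)
    have den: "of_real (R\<^sup>2) - cnj a * w \<noteq> 0" if w: "cmod w \<le> R" for w
    proof
      assume "of_real (R\<^sup>2) - cnj a * w = 0"
      then have "cmod (cnj a * w) = R\<^sup>2"
        by (metis eq_iff_diff_eq_0 norm_of_real abs_power2)
      moreover have "cmod a * cmod w \<le> cmod a * R"
        by (intro mult_left_mono w) auto
      moreover have "cmod a * R < R * R"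
        using aR0 R by (intro mult_strict_right_mono) auto
      ultimately show False
        by (simp add: norm_mult power2_eq_square)
    qed
    have "Re (\<psi> z / (of_real (R\<^sup>2) - cnj a * z)) < 0"
    proof (rule Re_negative_in_disc[of "\<lambda>w. \<psi> w / (of_real (R\<^sup>2) - cnj a * w)" R z])
      have "cball 0 R \<subseteq> unit_disc"
        using R by auto
      then show "(\<lambda>w. \<psi> w / (of_real (R\<^sup>2) - cnj a * w)) holomorphic_on cball 0 R"
        using den by (intro holomorphic_intros holomorphic_on_subset[OF holo_psi]) auto
      fix w :: complex
      assume w: "cmod w = R"
      define q where "q = \<psi> w / (of_real (R\<^sup>2) - cnj a * w)"
      have ww: "w * cnj w = of_real (R\<^sup>2)"
        using w complex_norm_square[of w] by simp
      have "\<phi> w * cnj w = (w - a) * cnj w * (q * (of_real (R\<^sup>2) - cnj a * w))"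
        using den[of w] w by (simp add: fact q_def)
      also have "\<dots> = (w * cnj w) * ((w - a) * cnj (w - a)) * q"
        unfolding ww[symmetric] by (simp add: algebra_simps)
      also have "\<dots> = of_real (R\<^sup>2 * (cmod (w - a))\<^sup>2) * q"
        unfolding ww by (simp only: complex_norm_square[symmetric] of_real_mult of_real_power)
      finally have "Re (\<phi> w * cnj w) = R\<^sup>2 * (cmod (w - a))\<^sup>2 * Re q"
        by simp
      moreover have "Re (\<phi> w * cnj w) < 0"
        using inward w R by simp
      moreover have "0 \<le> R\<^sup>2 * (cmod (w - a))\<^sup>2"
        by simp
      ultimately have "Re q < 0"
        by (metis mult_nonneg_nonneg not_le)
      then show "Re (\<psi> w / (of_real (R\<^sup>2) - cnj a * w)) < 0"
        by (simp add: q_def)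
    qed (use R in auto)
    then show ?thesis
      by auto
  qed
  with aR0 holo_psi fact that show ?thesis
    by blast
qed

section \<open>The Schwarz-Pick inequality and its first variation\<close>

text \<open>
  This form without denominators remains meaningful when the two points or their images coincide and
  can be differentiated in a parameter.
\<close>

lemma Schwarz_Pick_two_points:
  assumes holo: "g holomorphic_on unit_disc" and maps: "g ` unit_disc \<subseteq> unit_disc"
    and a: "cmod a < 1" and b: "cmod b < 1"
  shows "cmod (g b - g a) * cmod (1 - cnj a * b) \<le> cmod (b - a) * cmod (1 - cnj (g a) * g b)"
proof -
  have ga: "cmod (g a) < 1" and gb: "cmod (g b) < 1"
    using maps a b by (auto simp: image_subset_iff)
  have den: "1 - cnj u * v \<noteq> 0" if "cmod u < 1" "cmod v < 1" for u v
  proof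
    assume "1 - cnj u * v = 0"
    then have "cmod u * cmod v = 1"
      by (metis complex_mod_cnj eq_iff_diff_eq_0 norm_mult norm_one)
    moreover have "cmod u * cmod v < 1 * 1"
      using that by (intro mult_strict_mono') auto
    ultimately show False
      by simp
  qed
  define F where "F = Moebius_function 0 (g a) \<circ> (g \<circ> Moebius_function 0 (-a))"
  have maps_M: "Moebius_function 0 u ` unit_disc \<subseteq> unit_disc" if "cmod u < 1" for u
    using that Moebius_function_norm_lt_1 by auto
  have "cmod (F (Moebius_function 0 a b)) \<le> cmod (Moebius_function 0 a b)"
  proof (rule Schwarz_Lemma)
    have "(g \<circ> Moebius_function 0 (-a)) holomorphic_on unit_disc"
      using a maps_M[of "-a"]
      by (intro holomorphic_on_compose_gen[OF Moebius_function_holomorphic holo]) auto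
    then show "F holomorphic_on ball 0 1"
      unfolding F_def using maps maps_M[of "-a"] a ga
      by (intro holomorphic_on_compose_gen[OF _ Moebius_function_holomorphic])
        (auto simp: image_subset_iff)
    show "F 0 = 0"
      by (simp add: F_def Moebius_function_of_zero Moebius_function_eq_zero)
    show "cmod (F z) < 1" if "cmod z < 1" for z
      using maps maps_M[of "-a"] maps_M[of "g a"] a ga that
      by (auto simp: F_def image_subset_iff)
    show "cmod (Moebius_function 0 a b) < 1"
      using a b by (rule Moebius_function_norm_lt_1)
  qed
  moreover have "F (Moebius_function 0 a b) = Moebius_function 0 (g a) (g b)"
    using Moebius_function_compose[of "-a" a b] a b by (simp add: F_def)
  ultimately show ?thesis
    using den[OF a b] den[OF ga gb]
    by (simp add: Moebius_function_simple norm_divide field_simps)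
qed

text \<open>
  The first variation of the Schwarz-Pick inequality. Two points \<open>x < y\<close> of the real radius move along
  \<open>q\<close> and \<open>p\<close> without increasing their pseudo-hyperbolic distance. The difference \<open>N\<close> of the squared
  sides is nonpositive and vanishes at the start, so its initial derivative is nonpositive. Since both
  points are real at the start, this derivative is a positive multiple of the difference of the two
  sides of the claim.
\<close>

lemma tangent_inequality_of_contraction:
  fixes p q :: "real \<Rightarrow> complex"
  assumes p: "(p has_vector_derivative A) (at 0 within {0..1})" "p 0 = of_real y"
    and q: "(q has_vector_derivative B) (at 0 within {0..1})" "q 0 = of_real x"
    and xy: "0 \<le> x" "x < y" "y < 1"
    and contr: "\<And>s. s \<in> {0..1} \<Longrightarrow> cmod (p s - q s) * (1 - x * y) \<le> (y - x) * cmod (1 - cnj (q s) * p s)"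
  shows "Re A * (1 - x\<^sup>2) \<le> Re B * (1 - y\<^sup>2)"
proof -
  have [simp]: "Re (p 0) = y" "Im (p 0) = 0" "Re (q 0) = x" "Im (q 0) = 0"
    using p q by simp_all
  have d: "((\<lambda>s. Re (p s)) has_field_derivative Re A) (at 0 within {0..1})"
    "((\<lambda>s. Im (p s)) has_field_derivative Im A) (at 0 within {0..1})"
    "((\<lambda>s. Re (q s)) has_field_derivative Re B) (at 0 within {0..1})"
    "((\<lambda>s. Im (q s)) has_field_derivative Im B) (at 0 within {0..1})"
    using p(1) q(1)
    by (auto simp: has_real_derivative_iff_has_vector_derivative
        intro!: bounded_linear.has_vector_derivative[OF bounded_linear_Re]
          bounded_linear.has_vector_derivative[OF bounded_linear_Im])
  define N where "N s = ((Re (p s) - Re (q s))\<^sup>2 + (Im (p s) - Im (q s))\<^sup>2) * (1 - x * y)\<^sup>2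
     - (y - x)\<^sup>2 * ((1 - (Re (q s) * Re (p s) + Im (q s) * Im (p s)))\<^sup>2
        + (Re (q s) * Im (p s) - Im (q s) * Re (p s))\<^sup>2)" for s
  have N: "N s = (cmod (p s - q s) * (1 - x * y))\<^sup>2 - ((y - x) * cmod (1 - cnj (q s) * p s))\<^sup>2" for s
    by (simp add: N_def cmod_power2 power_mult_distrib power2_commute[of "Im (q s) * Re (p s)"])
  have xy1: "x * y < 1"
    using xy mult_strict_mono'[of x 1 y 1] by simp
  have N_le: "N s \<le> 0" if "s \<in> {0..1}" for s
    unfolding N using power_mono[OF contr[OF that], of 2] xy xy1 by simp
  have "N 0 = 0"
    by (simp add: N_def power2_eq_square algebra_simps)
  have "(N has_field_derivative
      2 * (y - x) * (1 - x * y) * (Re A * (1 - x\<^sup>2) - Re B * (1 - y\<^sup>2))) (at 0 within {0..1})"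
  proof -
    define P Q S T where "P s = Re (p s) - Re (q s)" and "Q s = Im (p s) - Im (q s)"
      and "S s = 1 - (Re (q s) * Re (p s) + Im (q s) * Im (p s))"
      and "T s = Re (q s) * Im (p s) - Im (q s) * Re (p s)" for s
    have at_0: "P 0 = y - x" "Q 0 = 0" "S 0 = 1 - x * y" "T 0 = 0"
      by (simp_all add: P_def Q_def S_def T_def)
    have dPQ: "(P has_field_derivative Re A - Re B) (at 0 within {0..1})"
      "(Q has_field_derivative Im A - Im B) (at 0 within {0..1})"
      unfolding P_def Q_def by (intro DERIV_diff d)+
    have dS: "(S has_field_derivative - (Re B * y + Re A * x)) (at 0 within {0..1})"
      unfolding S_def
      by (rule DERIV_cong[OF DERIV_diff[OF DERIV_const
            DERIV_add[OF DERIV_mult[OF d(3,1)] DERIV_mult[OF d(4,2)]]]]) simp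
    have dT: "(T has_field_derivative Im A * x - Im B * y) (at 0 within {0..1})"
      unfolding T_def
      by (rule DERIV_cong[OF DERIV_diff[OF DERIV_mult[OF d(3,2)] DERIV_mult[OF d(4,1)]]]) simp
    have sq: "((\<lambda>s. (F s)\<^sup>2) has_field_derivative 2 * F' * F 0) (at 0 within {0..1})"
      if "(F has_field_derivative F') (at 0 within {0..1})" for F :: "real \<Rightarrow> real" and F'
      using DERIV_power[OF that, of 2] by (simp add: mult.assoc)
    have "N = (\<lambda>s. ((P s)\<^sup>2 + (Q s)\<^sup>2) * (1 - x * y)\<^sup>2 - (y - x)\<^sup>2 * ((S s)\<^sup>2 + (T s)\<^sup>2))"
      by (simp add: fun_eq_iff N_def P_def Q_def S_def T_def)
    moreover have "((\<lambda>s. ((P s)\<^sup>2 + (Q s)\<^sup>2) * (1 - x * y)\<^sup>2 - (y - x)\<^sup>2 * ((S s)\<^sup>2 + (T s)\<^sup>2))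
        has_field_derivative (2 * (Re A - Re B) * (y - x)) * (1 - x * y)\<^sup>2
          - (y - x)\<^sup>2 * (2 * - (Re B * y + Re A * x) * (1 - x * y))) (at 0 within {0..1})"
      by (rule DERIV_cong[OF DERIV_diff[OF DERIV_cmult_right[OF DERIV_add[OF sq[OF dPQ(1)] sq[OF dPQ(2)]]]
            DERIV_cmult[OF DERIV_add[OF sq[OF dS] sq[OF dT]]]]]) (simp add: at_0)
    moreover have "(2 * (Re A - Re B) * (y - x)) * (1 - x * y)\<^sup>2
          - (y - x)\<^sup>2 * (2 * - (Re B * y + Re A * x) * (1 - x * y))
        = 2 * (y - x) * (1 - x * y) * (Re A * (1 - x\<^sup>2) - Re B * (1 - y\<^sup>2))"
      by (simp add: algebra_simps power2_eq_square)
    ultimately show ?thesis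
      by simp
  qed
  then have lim: "((\<lambda>s. (N s - N 0) / (s - 0)) \<longlongrightarrow>
      2 * (y - x) * (1 - x * y) * (Re A * (1 - x\<^sup>2) - Re B * (1 - y\<^sup>2))) (at 0 within {0..1})"
    by (simp only: has_field_derivative_iff)
  have "at (0::real) within {0..1} \<noteq> bot"
    by (simp add: trivial_limit_within)
  moreover have "\<forall>\<^sub>F s in at 0 within {0..1}. (N s - N 0) / (s - 0) \<le> 0"
    unfolding eventually_at_filter using N_le \<open>N 0 = 0\<close>
    by (auto simp: divide_nonpos_nonneg intro!: always_eventually)
  ultimately have "2 * (y - x) * (1 - x * y) * (Re A * (1 - x\<^sup>2) - Re B * (1 - y\<^sup>2)) \<le> 0"
    by (intro tendsto_upperbound[OF lim])
  moreover have "0 < 2 * (y - x) * (1 - x * y)"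
    using xy xy1 by simp
  ultimately have "Re A * (1 - x\<^sup>2) - Re B * (1 - y\<^sup>2) \<le> 0"
    by (metis mult_pos_pos not_le)
  then show ?thesis
    by simp
qed

lemma Re_of_real_mult: "Re (of_real r * w) = r * Re w"
  by simp

text \<open>
  This expresses that a radius of the disc has infinite hyperbolic length; it supplies a radius that
  depends only on the bounds \<open>C\<close> and \<open>k\<close>.
\<close>

lemma artanh_eventually_large:
  fixes k C :: real
  assumes "0 < k"
  obtains R where "0 \<le> R" "R < 1" "\<And>r. \<lbrakk>R < r; r < 1\<rbrakk> \<Longrightarrow> C < k * artanh r"
proof -
  have "\<forall>\<^sub>F r in at_left 1. C / k < artanh r"
    using artanh_real_at_left_1 by (simp add: filterlim_at_top_dense)
  then obtain b where b: "b < 1" "\<And>r. \<lbrakk>b < r; r < 1\<rbrakk> \<Longrightarrow> C / k < artanh r"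
    unfolding eventually_at_left_field by blast
  show ?thesis
    using b assms by (intro that[of "max 0 b"]) (auto simp: divide_less_eq mult.commute)
qed

section \<open>Calculus of the bilinear product and of complex gradients\<close>

lemma bounded_bilinear_scalar_product:
  "bounded_bilinear (scalar_product :: complex ^ 'n \<Rightarrow> complex ^ 'n \<Rightarrow> complex)"
proof
  show "\<exists>K. \<forall>a b :: complex ^ 'n. cmod (scalar_product a b) \<le> norm a * norm b * K"
  proof (intro exI allI)
    fix a b :: "complex ^ 'n"
    have "cmod (scalar_product a b) \<le> (\<Sum>i\<in>(UNIV :: 'n set). norm a * norm b)"
      unfolding scalar_product_def
      by (intro sum_norm_le) (auto simp: norm_mult intro!: mult_mono Finite_Cartesian_Product.norm_nth_le)
    then show "cmod (scalar_product a b) \<le> norm a * norm b * real CARD('n)"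
      by (simp add: mult.commute)
  qed
qed (auto simp: scalar_product_def algebra_simps sum.distrib scaleR_right.sum)

interpretation sp: bounded_bilinear "scalar_product :: complex ^ 'n \<Rightarrow> complex ^ 'n \<Rightarrow> complex"
  by (rule bounded_bilinear_scalar_product)

lemma scalar_product_commute: "scalar_product a b = scalar_product b (a :: complex ^ 'n)"
  by (simp add: scalar_product_def mult.commute)

lemma scalar_product_smult: "scalar_product a (c *s b) = c * scalar_product a (b :: complex ^ 'n)"
  by (simp add: scalar_product_def sum_distrib_left mult_ac)

lemma scalar_product_axis: "scalar_product a (axis j 1) = (a :: complex ^ 'n) $ j"
  by (simp add: scalar_product_def axis_def if_distrib cong: if_cong)

lemma norm_axis: "norm (axis j c :: complex ^ 'n) = cmod c"
proof -
  have "(norm (axis j c $ i))\<^sup>2 = (if i = j then (cmod c)\<^sup>2 else 0)" for i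
    by (simp add: axis_def)
  then show ?thesis
    by (simp add: norm_vec_def L2_set_def)
qed

lemma curve_has_derivative:
  fixes F :: "complex \<Rightarrow> complex ^ 'n"
  assumes "\<And>j. ((\<lambda>\<zeta>. F \<zeta> $ j) has_field_derivative F' $ j) (at \<mu>)"
  shows "(F has_derivative (\<lambda>t. t *s F')) (at \<mu>)"
proof -
  have lin: "bounded_linear (axis j :: complex \<Rightarrow> complex ^ 'n)" for j
    unfolding linear_conv_bounded_linear[symmetric]
    by (auto simp: linear_iff axis_def vec_eq_iff)
  have "((\<lambda>\<zeta>. \<Sum>j\<in>UNIV. axis j (F \<zeta> $ j)) has_derivative (\<lambda>t. \<Sum>j\<in>UNIV. axis j (F' $ j * t))) (at \<mu>)"
    by (intro has_derivative_sum bounded_linear.has_derivative[OF lin]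
        assms[unfolded has_field_derivative_def])
  moreover have "(\<Sum>j\<in>UNIV. axis j (v $ j)) = v" for v :: "complex ^ 'n"
    by (simp add: vec_eq_iff axis_def if_distrib cong: if_cong)
  from this this[of "t *s F'" for t]
  have "(\<lambda>\<zeta>. \<Sum>j\<in>UNIV. axis j (F \<zeta> $ j)) = F" 
    "(\<lambda>t. \<Sum>j\<in>UNIV. axis j (F' $ j * t)) = (\<lambda>t. t *s F')"
    by (simp_all add: mult.commute)
  ultimately show ?thesis
    by simp
qed

lemma has_field_derivative_along_curve:
  fixes F :: "complex \<Rightarrow> complex ^ 'n"
  assumes G: "(G has_derivative scalar_product a) (at (F \<mu>))"
    and F: "\<And>j. ((\<lambda>\<zeta>. F \<zeta> $ j) has_field_derivative F' $ j) (at \<mu>)"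
  shows "((\<lambda>\<zeta>. G (F \<zeta>)) has_field_derivative scalar_product a F') (at \<mu>)"
  using has_derivative_compose[OF curve_has_derivative[OF F] G]
  by (simp add: has_field_derivative_def scalar_product_smult mult.commute[of _ "scalar_product a F'"])

lemma complex_gradient_eq:
  fixes z :: "complex ^ 'n"
  assumes "(G has_derivative scalar_product a) (at z)"
  shows "complex_gradient G z = a"
proof -
  have "((\<lambda>w. G (\<chi> k. if k = j then w else z $ k)) has_field_derivative scalar_product a (axis j 1))
      (at (z $ j))" for j
  proof (rule has_field_derivative_along_curve)
    have "(\<chi> k. if k = j then z $ j else z $ k) = z"
      by (simp add: vec_eq_iff)
    then show "(G has_derivative scalar_product a) (at (\<chi> k. if k = j then z $ j else z $ k))"
      using assms by simp
    show "((\<lambda>\<zeta>. (\<chi> k. if k = j then \<zeta> else z $ k) $ i) has_field_derivative axis j 1 $ i) (at (z $ j))" for i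
      by (cases "i = j") (auto simp: axis_def)
  qed
  then show ?thesis
    by (simp add: complex_gradient_def vec_eq_iff DERIV_imp_deriv scalar_product_axis)
qed

lemma has_derivative_complex_gradient:
  assumes "holomorphic_fun_on G D" and "z \<in> D"
  shows "(G has_derivative scalar_product (complex_gradient G z)) (at z)"
  using assms complex_gradient_eq unfolding holomorphic_fun_on_def by metis

lemma holomorphic_on_along_curve:
  assumes G: "holomorphic_fun_on G D" and F: "holomorphic_curve_on F S" and "open S"
    and "\<And>\<zeta>. \<zeta> \<in> S \<Longrightarrow> F \<zeta> \<in> D"
  shows "(\<lambda>\<zeta>. G (F \<zeta>)) holomorphic_on S"
proof (subst holomorphic_on_open[OF \<open>open S\<close>], intro ballI exI)
  fix \<zeta> assume "\<zeta> \<in> S"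
  show "((\<lambda>\<zeta>. G (F \<zeta>)) has_field_derivative
      scalar_product (complex_gradient G (F \<zeta>)) (\<chi> j. deriv (\<lambda>\<zeta>. F \<zeta> $ j) \<zeta>)) (at \<zeta>)"
    using \<open>\<zeta> \<in> S\<close> F assms(3,4) unfolding holomorphic_curve_on_def
    by (intro has_field_derivative_along_curve has_derivative_complex_gradient[OF G])
      (auto intro: holomorphic_derivI)
qed

lemma continuous_on_holomorphic_curve:
  "holomorphic_curve_on F S \<Longrightarrow> continuous_on S F"
  unfolding holomorphic_curve_on_def continuous_on_def
  by (metis holomorphic_on_imp_continuous_on continuous_on_def vec_tendstoI)

text \<open>
  Caratheodory's characterization of the derivative by a slope that is continuous at the point: it
  reduces differentiability of an implicitly defined function to its continuity.
\<close>

lemma has_derivative_of_slope: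
  fixes k :: "complex ^ 'n \<Rightarrow> complex ^ 'n"
  assumes "open S" "z0 \<in> S" and slope: "\<And>z. z \<in> S \<Longrightarrow> F z - F z0 = scalar_product (k z) (z - z0)"
    and "isCont k z0"
  shows "(F has_derivative scalar_product (k z0)) (at z0)"
  unfolding has_derivative_iff_norm
proof
  show "bounded_linear (scalar_product (k z0))"
    by (rule sp.bounded_linear_right)
  obtain K where K: "\<And>a b :: complex ^ 'n. cmod (scalar_product a b) \<le> norm a * norm b * K"
    using sp.pos_bounded by blast
  have "\<forall>\<^sub>F z in at z0. z \<in> S \<and> z \<noteq> z0"
    using assms(1,2) by (auto simp: eventually_at_filter elim: eventually_mono[OF eventually_nhds_in_open])
  then have "\<forall>\<^sub>F z in at z0. norm (cmod (F z - F z0 - scalar_product (k z0) (z - z0)) / norm (z - z0))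
      \<le> norm (k z - k z0) * K"
  proof eventually_elim
    case (elim z)
    have "F z - F z0 - scalar_product (k z0) (z - z0) = scalar_product (k z - k z0) (z - z0)"
      using slope elim by (simp add: sp.diff_left)
    then show ?case
      using K[of "k z - k z0" "z - z0"] elim by (simp add: divide_le_eq mult_ac)
  qed
  moreover have "((\<lambda>z. norm (k z - k z0) * K) \<longlongrightarrow> norm (k z0 - k z0) * K) (at z0)"
    using \<open>isCont k z0\<close> unfolding isCont_def by (intro tendsto_intros)
  then have "((\<lambda>z. norm (k z - k z0) * K) \<longlongrightarrow> 0) (at z0)"
    by simp
  ultimately show "((\<lambda>z. cmod (F z - F z0 - scalar_product (k z0) (z - z0)) / norm (z - z0)) \<longlongrightarrow> 0) (at z0)"
    by (rule Lim_null_comparison)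
qed

section \<open>Holomorphy of the gradient along a curve\<close>

text \<open>
  A second order Taylor estimate whose constant depends only on the radius, so that it applies
  uniformly to a family of functions bounded by \<open>1\<close>. The value \<open>32\<close> comes from Cauchy's estimate of
  the second derivative on discs of radius \<open>\<delta> / 4\<close>.
\<close>

lemma difference_quotient_estimate:
  assumes holo: "k holomorphic_on ball 0 \<delta>" and bound: "\<And>\<xi>. \<xi> \<in> ball 0 \<delta> \<Longrightarrow> cmod (k \<xi>) \<le> 1"
    and \<xi>: "0 < cmod \<xi>" "cmod \<xi> \<le> \<delta> / 2"
  shows "cmod ((k \<xi> - k 0) / \<xi> - deriv k 0) \<le> 32 / \<delta>\<^sup>2 * cmod \<xi>"
proof -
  have \<delta>: "0 < \<delta>"
    using \<xi> by linarith
  have "cmod ((deriv ^^ 0) k \<xi> - (\<Sum>i\<le>1. (deriv ^^ i) k 0 * (\<xi> - 0) ^ i / fact i))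
      \<le> 32 / \<delta>\<^sup>2 * cmod (\<xi> - 0) ^ Suc 1 / fact 1"
  proof (rule complex_Taylor[of "cball 0 (\<delta> / 2)" 1 "\<lambda>i. (deriv ^^ i) k"])
    fix i x
    assume x: "x \<in> cball (0::complex) (\<delta> / 2)"
    then have x': "x \<in> ball 0 \<delta>"
      using \<delta> by simp
    have "(deriv ^^ i) k holomorphic_on ball 0 \<delta>"
      by (intro holomorphic_higher_deriv holo) simp
    then show "((deriv ^^ i) k has_field_derivative (deriv ^^ Suc i) k x)
        (at x within cball 0 (\<delta> / 2))"
      using holomorphic_derivI[OF _ open_ball x'] by (simp add: has_field_derivative_at_within)
    have sub: "cball x (\<delta> / 4) \<subseteq> ball 0 \<delta>"
    proof
      fix y assume "y \<in> cball x (\<delta> / 4)"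
      then have "cmod (y - x) \<le> \<delta> / 4"
        by (simp add: dist_norm norm_minus_commute)
      then show "y \<in> ball 0 \<delta>"
        using x norm_triangle_ineq[of "y - x" x] \<delta> by simp
    qed
    have "cmod ((deriv ^^ 2) k x) \<le> fact 2 * 1 / (\<delta> / 4) ^ 2"
    proof (rule Cauchy_inequality)
      show "k holomorphic_on ball x (\<delta> / 4)"
        using sub by (intro holomorphic_on_subset[OF holo]) auto
      show "continuous_on (cball x (\<delta> / 4)) k"
        using sub by (intro holomorphic_on_imp_continuous_on holomorphic_on_subset[OF holo])
      show "cmod (k y) \<le> 1" if "cmod (x - y) = \<delta> / 4" for y
        using sub that by (intro bound) (auto simp: dist_norm)
    qed (use \<delta> in simp)
    then show "cmod ((deriv ^^ Suc 1) k x) \<le> 32 / \<delta>\<^sup>2"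
      by (simp add: power2_eq_square numeral_2_eq_2 field_simps)
  next
    show "\<xi> \<in> cball 0 (\<delta> / 2)" "0 \<in> cball (0::complex) (\<delta> / 2)"
      using \<delta> \<xi>(2) by simp_all
  qed simp
  then have "cmod (k \<xi> - k 0 - deriv k 0 * \<xi>) \<le> 32 / \<delta>\<^sup>2 * cmod \<xi> * cmod \<xi>"
    by (simp add: power2_eq_square algebra_simps)
  moreover have "(k \<xi> - k 0) / \<xi> - deriv k 0 = (k \<xi> - k 0 - deriv k 0 * \<xi>) / \<xi>"
    using \<xi> by (auto simp: field_simps)
  ultimately show ?thesis
    using \<xi> by (simp add: norm_divide pos_divide_le_eq)
qed

text \<open>
  The definition of holomorphy of \<open>G\<close> requires only a complex linear derivative at each point, so
  regularity of the partial derivatives is not immediate. Along the curve, a partial derivative is the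
  limit of difference quotients that are holomorphic in the curve parameter, and the bound on \<open>G\<close>
  makes the convergence locally uniform.
\<close>

lemma holomorphic_gradient_along_curve:
  fixes G :: "complex ^ 'n \<Rightarrow> complex"
  assumes G: "holomorphic_fun_on G D" "G ` D \<subseteq> unit_disc" and "open D"
    and F: "holomorphic_curve_on F S" "F ` S \<subseteq> D" and "open S"
  shows "holomorphic_curve_on (\<lambda>\<zeta>. complex_gradient G (F \<zeta>)) S"
  unfolding holomorphic_curve_on_def
proof (intro allI holomorphic_onI)
  fix j \<zeta>0 assume \<zeta>0: "\<zeta>0 \<in> S"
  then obtain \<epsilon> where \<epsilon>: "0 < \<epsilon>" "ball (F \<zeta>0) \<epsilon> \<subseteq> D"
    using F(2) \<open>open D\<close> by (metis image_subset_iff openE)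
  define \<delta> where "\<delta> = \<epsilon> / 2"
  have \<delta>: "0 < \<delta>"
    using \<epsilon> by (simp add: \<delta>_def)
  have "isCont F \<zeta>0"
    using continuous_on_holomorphic_curve[OF F(1)] \<open>open S\<close> \<zeta>0
    by (simp add: continuous_on_eq_continuous_at)
  then have "\<forall>\<^sub>F \<zeta> in nhds \<zeta>0. dist (F \<zeta>) (F \<zeta>0) < \<delta> \<and> \<zeta> \<in> S"
    using \<delta> \<open>open S\<close> \<zeta>0
    by (intro eventually_conj)
      (auto simp: isCont_def tendsto_iff eventually_at_filter eventually_nhds_in_open elim!: eventually_mono)
  then obtain d where d: "0 < d" "\<And>\<zeta>. \<zeta> \<in> ball \<zeta>0 d \<Longrightarrow> dist (F \<zeta>) (F \<zeta>0) < \<delta> \<and> \<zeta> \<in> S"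
    by (auto simp: eventually_nhds_metric dist_commute)
  define g where "g \<zeta> \<xi> = G (F \<zeta> + \<xi> *s axis j 1)" for \<zeta> \<xi>
  have in_D: "F \<zeta> + \<xi> *s axis j 1 \<in> D" if "\<zeta> \<in> ball \<zeta>0 d" "cmod \<xi> < \<delta>" for \<zeta> \<xi>
  proof -
    have "\<xi> *s axis j 1 = (axis j \<xi> :: complex ^ 'n)"
      by (simp add: vec_eq_iff axis_def)
    then have "norm (\<xi> *s axis j 1 :: complex ^ 'n) < \<delta>"
      using that norm_axis[of j \<xi>] by simp
    then have "dist (F \<zeta>0) (F \<zeta> + \<xi> *s axis j 1) < \<delta> + \<delta>"
      using d(2)[OF that(1)] dist_triangle_lt[of "F \<zeta>0" "F \<zeta>" "F \<zeta> + \<xi> *s axis j 1"]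
      by (smt (verit) dist_add_cancel dist_commute dist_norm dist_triangle add_diff_cancel_left' norm_minus_commute)
    then show ?thesis
      using \<epsilon> by (auto simp: \<delta>_def)
  qed
  have deriv_g: "deriv (g \<zeta>) 0 = complex_gradient G (F \<zeta>) $ j" if "\<zeta> \<in> ball \<zeta>0 d" for \<zeta>
  proof (rule DERIV_imp_deriv)
    have "(g \<zeta> has_field_derivative scalar_product (complex_gradient G (F \<zeta>)) (axis j 1)) (at 0)"
      unfolding g_def using in_D[OF that, of 0] \<delta>
      by (intro has_field_derivative_along_curve)
        (auto intro!: derivative_eq_intros has_derivative_complex_gradient[OF G(1)])
    then show "(g \<zeta> has_field_derivative complex_gradient G (F \<zeta>) $ j) (at 0)"
      by (simp add: scalar_product_axis)
  qed
  have holo_g: "g \<zeta> holomorphic_on ball 0 \<delta>" if "\<zeta> \<in> ball \<zeta>0 d" for \<zeta>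
    unfolding g_def using in_D[OF that]
    by (intro holomorphic_on_along_curve[OF G(1)])
      (auto simp: holomorphic_curve_on_def intro!: holomorphic_intros)
  define c :: "nat \<Rightarrow> complex" where "c n = of_real (\<delta> / 2 * (1 / (n + 1)))" for n
  have cmod_c: "cmod (c n) = \<delta> / 2 * (1 / real (Suc n))" for n
    using \<delta> unfolding c_def norm_of_real by simp
  have c: "0 < cmod (c n)" "cmod (c n) \<le> \<delta> / 2" for n
    using \<delta> by (auto simp: cmod_c field_simps)
  have "(\<lambda>\<zeta>. complex_gradient G (F \<zeta>) $ j) holomorphic_on ball \<zeta>0 d"
  proof (rule holomorphic_uniform_sequence)
    show "(\<lambda>\<zeta>. (g \<zeta> (c n) - g \<zeta> 0) / c n) holomorphic_on ball \<zeta>0 d" for n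
    proof -
      have "ball \<zeta>0 d \<subseteq> S"
        using d(2) by blast
      then have F': "(\<lambda>\<zeta>. F \<zeta> $ i) holomorphic_on ball \<zeta>0 d" for i
        using F(1) holomorphic_on_subset unfolding holomorphic_curve_on_def by blast
      have "(\<lambda>\<zeta>. g \<zeta> \<xi>) holomorphic_on ball \<zeta>0 d" if "cmod \<xi> < \<delta>" for \<xi>
        unfolding g_def using in_D[OF _ that]
        by (intro holomorphic_on_along_curve[OF G(1)])
          (auto simp: holomorphic_curve_on_def intro!: holomorphic_intros F')
      then show ?thesis
        using c[of n] \<delta> by (intro holomorphic_intros) auto
    qed
    have "uniform_limit (ball \<zeta>0 d) (\<lambda>n \<zeta>. (g \<zeta> (c n) - g \<zeta> 0) / c n)
        (\<lambda>\<zeta>. complex_gradient G (F \<zeta>) $ j) sequentially"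
    proof (rule uniform_limitI)
      fix e :: real assume "0 < e"
      have "(\<lambda>n. 32 / \<delta>\<^sup>2 * (\<delta> / 2 * (1 / real (Suc n)))) \<longlonglongrightarrow> 32 / \<delta>\<^sup>2 * (\<delta> / 2 * 0)"
        by (intro tendsto_intros lim_1_over_n[THEN LIMSEQ_Suc])
      then have "\<forall>\<^sub>F n in sequentially. 32 / \<delta>\<^sup>2 * (\<delta> / 2 * (1 / real (Suc n))) < e"
        using \<open>0 < e\<close> by (intro order_tendstoD(2)) auto
      then show "\<forall>\<^sub>F n in sequentially. \<forall>\<zeta>\<in>ball \<zeta>0 d.
          dist ((g \<zeta> (c n) - g \<zeta> 0) / c n) (complex_gradient G (F \<zeta>) $ j) < e"
      proof (eventually_elim, intro ballI)
        fix n \<zeta> assume n: "32 / \<delta>\<^sup>2 * (\<delta> / 2 * (1 / real (Suc n))) < e" and \<zeta>: "\<zeta> \<in> ball \<zeta>0 d"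
        have "cmod ((g \<zeta> (c n) - g \<zeta> 0) / c n - deriv (g \<zeta>) 0) \<le> 32 / \<delta>\<^sup>2 * cmod (c n)"
        proof (rule difference_quotient_estimate[OF holo_g[OF \<zeta>] _ c])
          show "cmod (g \<zeta> \<xi>) \<le> 1" if "\<xi> \<in> ball 0 \<delta>" for \<xi>
            using in_D[OF \<zeta>, of \<xi>] that G(2) by (force simp: g_def image_subset_iff)
        qed
        then show "dist ((g \<zeta> (c n) - g \<zeta> 0) / c n) (complex_gradient G (F \<zeta>) $ j) < e"
          using n by (simp add: dist_norm deriv_g[OF \<zeta>] cmod_c)
      qed
    qed
    then show "\<exists>r. 0 < r \<and> cball x r \<subseteq> ball \<zeta>0 d \<and>
        uniform_limit (cball x r) (\<lambda>n \<zeta>. (g \<zeta> (c n) - g \<zeta> 0) / c n)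
          (\<lambda>\<zeta>. complex_gradient G (F \<zeta>) $ j) sequentially" if "x \<in> ball \<zeta>0 d" for x
      using that by (meson open_ball open_contains_cball uniform_limit_on_subset)
  qed simp
  from holomorphic_on_imp_differentiable_at[OF this open_ball, of \<zeta>0]
  show "(\<lambda>\<zeta>. complex_gradient G (F \<zeta>) $ j) field_differentiable (at \<zeta>0 within S)"
    using \<open>0 < d\<close> by (simp only: centre_in_ball field_differentiable_at_within)
qed

section \<open>The equation defining the Lempert left inverse\<close>

definition lempert_form ::
    "(complex \<Rightarrow> complex ^ 'n) \<Rightarrow> (complex ^ 'n \<Rightarrow> complex) \<Rightarrow> complex ^ 'n \<Rightarrow> complex \<Rightarrow> complex" where
  "lempert_form f G z \<zeta> = scalar_product (z - f \<zeta>) (complex_gradient G (f \<zeta>))"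

locale geodesic_with_left_inverse =
  fixes D :: "(complex ^ 'n) set" and f :: "complex \<Rightarrow> complex ^ 'n" and G :: "complex ^ 'n \<Rightarrow> complex"
  assumes open_D: "open D" and bounded_D: "bounded D" and convex_D: "convex D"
    and holo_f: "holomorphic_curve_on f unit_disc" and f_in_D: "f ` unit_disc \<subseteq> D"
    and left_inv: "left_inverse D f G"
begin

lemma holo_G: "holomorphic_fun_on G D" and G_in_disc: "G ` D \<subseteq> unit_disc"
  and G_f: "\<zeta> \<in> unit_disc \<Longrightarrow> G (f \<zeta>) = \<zeta>"
  using left_inv by (auto simp: left_inverse_def)

abbreviation \<Phi> :: "complex ^ 'n \<Rightarrow> complex \<Rightarrow> complex" where
  "\<Phi> \<equiv> lempert_form f G"

lemma f_derivative:
  "\<zeta> \<in> unit_disc \<Longrightarrow> ((\<lambda>\<zeta>. f \<zeta> $ j) has_field_derivative (\<chi> j. deriv (\<lambda>\<zeta>. f \<zeta> $ j) \<zeta>) $ j) (at \<zeta>)"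
  using holo_f by (auto simp: holomorphic_curve_on_def intro: holomorphic_derivI)

text \<open>
  Differentiating \<open>G (f \<zeta>) = \<zeta>\<close> gives a normalization that makes the gradient nonzero along \<open>f\<close> and
  fixes the derivative of \<open>\<Phi> (f a)\<close> at its zero \<open>a\<close>.
\<close>

lemma scalar_product_tangent_gradient:
  assumes "\<zeta> \<in> unit_disc"
  shows "scalar_product (complex_gradient G (f \<zeta>)) (\<chi> j. deriv (\<lambda>\<zeta>. f \<zeta> $ j) \<zeta>) = 1"
proof (rule DERIV_unique)
  show "((\<lambda>\<zeta>. G (f \<zeta>)) has_field_derivative
      scalar_product (complex_gradient G (f \<zeta>)) (\<chi> j. deriv (\<lambda>\<zeta>. f \<zeta> $ j) \<zeta>)) (at \<zeta>)"
    using assms f_in_D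
    by (intro has_field_derivative_along_curve has_derivative_complex_gradient[OF holo_G] f_derivative) auto
  show "((\<lambda>\<zeta>. G (f \<zeta>)) has_field_derivative 1) (at \<zeta>)"
    by (rule has_field_derivative_transform_within_open[OF DERIV_ident open_ball assms]) (simp add: G_f)
qed

lemma gradient_nonzero: "\<zeta> \<in> unit_disc \<Longrightarrow> complex_gradient G (f \<zeta>) \<noteq> 0"
  using scalar_product_tangent_gradient[of \<zeta>] by (auto simp: sp.zero_left)

lemma holo_gradient: "holomorphic_curve_on (\<lambda>\<zeta>. complex_gradient G (f \<zeta>)) unit_disc"
  by (intro holomorphic_gradient_along_curve[OF holo_G G_in_disc open_D holo_f f_in_D] open_ball)

lemma holo_form: "\<Phi> z holomorphic_on unit_disc"
  using holo_f holo_gradient unfolding lempert_form_def scalar_product_def holomorphic_curve_on_def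
  by (auto intro!: holomorphic_intros)

lemma form_at_disc_point: "\<Phi> (f a) a = 0"
  by (simp add: lempert_form_def sp.zero_left)

text \<open>
  The derivative of the gradient is multiplied by \<open>f a - f \<zeta>\<close>, which vanishes at \<open>a\<close>; what remains is
  minus the normalized product of tangent and gradient.
\<close>

lemma form_derivative_at_disc_point:
  assumes a: "a \<in> unit_disc"
  shows "(\<Phi> (f a) has_field_derivative -1) (at a)"
proof -
  have "((\<lambda>\<zeta>. complex_gradient G (f \<zeta>) $ j) has_field_derivative
      deriv (\<lambda>\<zeta>. complex_gradient G (f \<zeta>) $ j) a) (at a)" for j
    using holo_gradient a by (auto simp: holomorphic_curve_on_def intro: holomorphic_derivI)
  note d = DERIV_mult[OF DERIV_diff[OF DERIV_const f_derivative[OF a]] this]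
  have "((\<lambda>\<zeta>. \<Sum>j\<in>UNIV. (f a $ j - f \<zeta> $ j) * complex_gradient G (f \<zeta>) $ j) has_field_derivative
      (\<Sum>j\<in>UNIV. - (complex_gradient G (f a) $ j * (\<chi> j. deriv (\<lambda>\<zeta>. f \<zeta> $ j) a) $ j))) (at a)"
    by (rule DERIV_sum, rule DERIV_cong[OF d]) simp
  moreover have "(\<Sum>j\<in>UNIV. - (complex_gradient G (f a) $ j * (\<chi> j. deriv (\<lambda>\<zeta>. f \<zeta> $ j) a) $ j)) = -1"
    using scalar_product_tangent_gradient[OF a] by (simp add: scalar_product_def sum_negf)
  moreover have "\<Phi> (f a) = (\<lambda>\<zeta>. \<Sum>j\<in>UNIV. (f a $ j - f \<zeta> $ j) * complex_gradient G (f \<zeta>) $ j)"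
    by (simp add: lempert_form_def scalar_product_def fun_eq_iff)
  ultimately show ?thesis
    by (simp only:)
qed

text \<open>
  For \<open>t \<ge> 0\<close>, read from right to left: \<open>\<Phi> z\<close> is the convex combination with weights \<open>1 / (1 + t)\<close> and
  \<open>t / (1 + t)\<close> of the forms at \<open>z + t (z - w)\<close> and at \<open>w\<close>.
\<close>

lemma form_affine: "\<Phi> (z + t *\<^sub>R (z - w)) \<zeta> = (1 + of_real t) * \<Phi> z \<zeta> - of_real t * \<Phi> w \<zeta>"
proof -
  have "z + t *\<^sub>R (z - w) - f \<zeta> = (1 + t) *\<^sub>R (z - f \<zeta>) - t *\<^sub>R (w - f \<zeta>)"
    by (simp add: algebra_simps)
  then show ?thesis
    unfolding lempert_form_def
    by (simp only: sp.diff_left sp.scaleR_left) (simp add: scaleR_conv_of_real algebra_simps)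
qed

lemma segment_in_D: "\<lbrakk>v \<in> D; w \<in> D; s \<in> {0..1}\<rbrakk> \<Longrightarrow> v + s *\<^sub>R (w - v) \<in> D"
  using convexD_alt[OF convex_D, of v w s] by (simp add: algebra_simps)

section \<open>Radial decay of the defining form\<close>

text \<open>
  The contractions \<open>g s\<close> in the proof move the point \<open>\<zeta>\<close> with initial velocity \<open>\<Phi> w \<zeta>\<close>. The
  Schwarz-Pick inequality for two points on the radius through \<open>e\<close>, rotated to the real axis and
  differentiated at \<open>s = 0\<close>, is the claim.
\<close>

lemma radial_monotonicity:
  assumes w: "w \<in> D" and e: "cmod e = 1" and xy: "0 \<le> x" "x < y" "y < 1"
  shows "Re (\<Phi> w (of_real y * e) * cnj e) * (1 - x\<^sup>2) \<le> Re (\<Phi> w (of_real x * e) * cnj e) * (1 - y\<^sup>2)"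
proof -
  define g where "g s \<zeta> = G (f \<zeta> + s *\<^sub>R (w - f \<zeta>))" for s \<zeta>
  have ee: "cnj e * e = 1"
    using complex_norm_square[of e] e by (simp add: mult.commute)
  have in_disc: "of_real r * e \<in> unit_disc" if "0 \<le> r" "r < 1" for r
    using that e by (simp add: norm_mult)
  have derivative: "((\<lambda>s. cnj e * g s (of_real r * e)) has_vector_derivative cnj e * \<Phi> w (of_real r * e))
      (at 0 within {0..1})" if r: "0 \<le> r" "r < 1" for r
  proof -
    define v where "v = f (of_real r * e)"
    have v: "v \<in> D"
      using in_disc[OF r] f_in_D by (auto simp: v_def)
    have "(G has_derivative scalar_product (complex_gradient G v)) (at (v + 0 *\<^sub>R (w - v)))"
      using has_derivative_complex_gradient[OF holo_G v] by simp
    moreover have "((\<lambda>s. v + s *\<^sub>R (w - v)) has_derivative (\<lambda>s. s *\<^sub>R (w - v))) (at 0 within {0..1})"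
      by (auto intro!: derivative_eq_intros)
    ultimately have "((\<lambda>s. G (v + s *\<^sub>R (w - v))) has_derivative
        (\<lambda>s. scalar_product (complex_gradient G v) (s *\<^sub>R (w - v)))) (at 0 within {0..1})"
      by (rule has_derivative_compose[rotated])
    then have "((\<lambda>s. G (v + s *\<^sub>R (w - v))) has_vector_derivative
        scalar_product (complex_gradient G v) (w - v)) (at 0 within {0..1})"
      by (simp add: has_vector_derivative_def sp.scaleR_right)
    then have "((\<lambda>s. cnj e * G (v + s *\<^sub>R (w - v))) has_vector_derivative
        cnj e * scalar_product (complex_gradient G v) (w - v)) (at 0 within {0..1})"
      by (rule has_vector_derivative_mult_right)
    then show ?thesis
      by (simp add: g_def v_def lempert_form_def scalar_product_commute)
  qed
  have start: "cnj e * g 0 (of_real r * e) = of_real r" if "0 \<le> r" "r < 1" for r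
    using G_f[OF in_disc[OF that]] ee by (simp add: g_def algebra_simps)
  have "Re (cnj e * \<Phi> w (of_real y * e)) * (1 - x\<^sup>2) \<le> Re (cnj e * \<Phi> w (of_real x * e)) * (1 - y\<^sup>2)"
  proof (rule tangent_inequality_of_contraction[OF derivative start derivative start xy])
    fix s :: real assume s: "s \<in> {0..1}"
    have in_D: "f \<zeta> + s *\<^sub>R (w - f \<zeta>) \<in> D" if "\<zeta> \<in> unit_disc" for \<zeta>
      using f_in_D that w s by (intro segment_in_D) auto
    have "cmod (g s (of_real y * e) - g s (of_real x * e)) * cmod (1 - cnj (of_real x * e) * (of_real y * e))
      \<le> cmod (of_real y * e - of_real x * e) * cmod (1 - cnj (g s (of_real x * e)) * g s (of_real y * e))"
    proof (rule Schwarz_Pick_two_points)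
      show "g s holomorphic_on unit_disc"
        unfolding g_def using in_D holo_f
        by (intro holomorphic_on_along_curve[OF holo_G])
          (auto simp: holomorphic_curve_on_def scaleR_conv_of_real intro!: holomorphic_intros)
      show "g s ` unit_disc \<subseteq> unit_disc"
        unfolding g_def using in_D G_in_disc by blast
    qed (use in_disc xy in auto)
    moreover have "cnj (of_real x * e) * (of_real y * e) = of_real (x * y)"
      using ee by (simp add: mult_ac)
    moreover have "cmod (1 - of_real (x * y)) = 1 - x * y"
    proof -
      have "x * y < 1"
        using xy mult_strict_mono'[of x 1 y 1] by simp
      then show ?thesis
        using norm_of_real[of "1 - x * y", where 'a=complex] by (simp del: norm_of_real)
    qed
    moreover have "cmod (of_real y * e - of_real x * e) = y - x"
    proof -
      have "of_real y * e - of_real x * e = of_real (y - x) * e"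
        by (simp add: left_diff_distrib)
      then show ?thesis
        using e xy by (simp only: norm_mult norm_of_real) simp
    qed
    moreover have "cmod (cnj e * g s (of_real y * e) - cnj e * g s (of_real x * e))
        = cmod (g s (of_real y * e) - g s (of_real x * e))"
      using e by (metis complex_mod_cnj mult_1 norm_mult right_diff_distrib)
    moreover have "cnj (cnj e * g s (of_real x * e)) * (cnj e * g s (of_real y * e))
        = cnj (g s (of_real x * e)) * g s (of_real y * e)"
      using ee by (simp add: mult_ac)
    ultimately show "cmod (cnj e * g s (of_real y * e) - cnj e * g s (of_real x * e)) * (1 - x * y)
        \<le> (y - x) * cmod (1 - cnj (cnj e * g s (of_real x * e)) * (cnj e * g s (of_real y * e)))"
      by (simp only:)
  qed (use xy in auto)
  then show ?thesis
    by (simp add: mult.commute)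
qed

text \<open>
  At each point \<open>a\<close> of the radius, monotonicity is applied to the form at \<open>z + \<epsilon> (z - f a)\<close>, which is
  \<open>(1 + \<epsilon>) \<Phi> z - \<epsilon> \<Phi> (f a)\<close>. The subtracted term is known to first order at \<open>a\<close> and turns monotonicity
  into a definite rate of decay. Integrating the rate \<open>\<epsilon> / (1 + \<epsilon>) / (1 - x\<^sup>2)\<close> gives the \<open>artanh\<close>.
\<close>

lemma radial_decay:
  assumes z: "z \<in> D" and \<epsilon>: "0 < \<epsilon>" and shift: "\<And>a. a \<in> unit_disc \<Longrightarrow> z + \<epsilon> *\<^sub>R (z - f a) \<in> D"
    and e: "cmod e = 1" and r: "0 \<le> r" "r < 1"
  shows "Re (\<Phi> z (of_real r * e) * cnj e) / (1 - r\<^sup>2) \<le> Re (\<Phi> z 0 * cnj e) - \<epsilon> / (1 + \<epsilon>) * artanh r"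
proof -
  define u where "u w x = Re (\<Phi> w (of_real x * e) * cnj e) / (1 - x\<^sup>2)" for w x
  have ee: "e * cnj e = 1"
    using complex_norm_square[of e] e by simp
  have sq: "x\<^sup>2 < 1" if "0 \<le> x" "x < 1" for x :: real
    using that by (simp add: abs_square_less_1)
  have in_disc: "of_real x * e \<in> unit_disc" if "0 \<le> x" "x < 1" for x
    using that e by (simp add: norm_mult)
  have u_deriv: "(u w has_field_derivative
      (Re (d * e * cnj e) * (1 - x\<^sup>2) + Re (\<Phi> w (of_real x * e) * cnj e) * (2 * x)) / ((1 - x\<^sup>2) * (1 - x\<^sup>2))) (at x)"
    if d: "(\<Phi> w has_field_derivative d) (at (of_real x * e))" and x: "0 \<le> x" "x < 1" for w d x
  proof -
    have "((\<lambda>x. of_real x * e) has_vector_derivative e) (at x)"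
      by (auto intro!: derivative_eq_intros)
    from field_vector_diff_chain_at[OF this d]
    have "((\<lambda>x. \<Phi> w (of_real x * e)) has_vector_derivative e * d) (at x)"
      by (simp add: o_def)
    then have "((\<lambda>x. Re (\<Phi> w (of_real x * e) * cnj e)) has_field_derivative Re (e * d * cnj e)) (at x)"
      unfolding has_real_derivative_iff_has_vector_derivative
      by (intro bounded_linear.has_vector_derivative[OF bounded_linear_Re] has_vector_derivative_mult_left)
    moreover have "((\<lambda>x. 1 - x\<^sup>2) has_field_derivative - (2 * x)) (at x)"
      by (auto intro!: derivative_eq_intros)
    ultimately have "((\<lambda>x. Re (\<Phi> w (of_real x * e) * cnj e) / (1 - x\<^sup>2)) has_field_derivative
        (Re (e * d * cnj e) * (1 - x\<^sup>2) - Re (\<Phi> w (of_real x * e) * cnj e) * - (2 * x))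
          / ((1 - x\<^sup>2) * (1 - x\<^sup>2))) (at x)"
      using sq[OF x] by (intro DERIV_divide) auto
    moreover have "u w = (\<lambda>x. Re (\<Phi> w (of_real x * e) * cnj e) / (1 - x\<^sup>2))"
      by (simp add: u_def fun_eq_iff)
    ultimately show ?thesis
      by (simp only: mult.commute[of e d] mult_minus_right diff_minus_eq_add)
  qed
  define k where "k = \<epsilon> / (1 + \<epsilon>)"
  have "u z 0 + k * artanh 0 \<ge> u z r + k * artanh r"
  proof (rule DERIV_nonpos_imp_nonincreasing[OF r(1)])
    fix x assume "0 \<le> x" "x \<le> r"
    then have x: "0 \<le> x" "x < 1"
      using r by auto
    define a where "a = of_real x * e"
    have a: "a \<in> unit_disc"
      using in_disc[OF x] by (simp add: a_def)
    have "(\<Phi> z has_field_derivative deriv (\<Phi> z) a) (at a)"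
      by (rule holomorphic_derivI[OF holo_form open_ball a])
    from u_deriv[OF this[unfolded a_def] x] obtain U where U: "(u z has_field_derivative U) (at x)"
      by blast
    have "(u (f a) has_field_derivative
        (Re (- 1 * e * cnj e) * (1 - x\<^sup>2) + Re (\<Phi> (f a) a * cnj e) * (2 * x)) / ((1 - x\<^sup>2) * (1 - x\<^sup>2))) (at x)"
      using u_deriv[OF form_derivative_at_disc_point[OF a, unfolded a_def] x] by (simp only: a_def)
    then have "(u (f a) has_field_derivative - (1 / (1 - x\<^sup>2))) (at x)"
      by (rule DERIV_cong) (use sq[OF x] ee in \<open>simp add: form_at_disc_point mult.assoc divide_simps\<close>)
    from DERIV_diff[OF DERIV_cmult[OF U, of "1 + \<epsilon>"] DERIV_cmult[OF this, of \<epsilon>]]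
    have der: "((\<lambda>y. (1 + \<epsilon>) * u z y - \<epsilon> * u (f a) y) has_field_derivative (1 + \<epsilon>) * U + \<epsilon> / (1 - x\<^sup>2)) (at x)"
      by simp
    have combination: "(1 + \<epsilon>) * u z y - \<epsilon> * u (f a) y = u (z + \<epsilon> *\<^sub>R (z - f a)) y" for y
      unfolding u_def form_affine by (simp add: algebra_simps add_divide_distrib diff_divide_distrib)
    have "(1 + \<epsilon>) * U + \<epsilon> / (1 - x\<^sup>2) \<le> 0"
    proof (rule ccontr)
      assume "\<not> ?thesis"
      then obtain \<delta> where \<delta>: "0 < \<delta>" and incr: "\<And>h. \<lbrakk>0 < h; h < \<delta>\<rbrakk> \<Longrightarrow>
          u (z + \<epsilon> *\<^sub>R (z - f a)) x < u (z + \<epsilon> *\<^sub>R (z - f a)) (x + h)"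
        using DERIV_pos_inc_right[OF der] unfolding combination by force
      \<comment> \<open>A step to the right inside the disc, short enough for the assumed growth to be visible.\<close>
      define h where "h = min \<delta> (1 - x) / 2"
      have h: "0 < h" "h < \<delta>" "x + h < 1"
        using \<delta> x by (auto simp: h_def min_def field_simps)
      have "u (z + \<epsilon> *\<^sub>R (z - f a)) (x + h) \<le> u (z + \<epsilon> *\<^sub>R (z - f a)) x"
        using radial_monotonicity[OF shift[OF a] e x(1), of "x + h"] h x sq[of x] sq[of "x + h"]
        by (simp add: u_def frac_le_eq divide_simps mult.commute)
      with incr[OF h(1,2)] show False
        by simp
    qed
    moreover have "(1 + \<epsilon>) * (U + k * (1 / (1 - x\<^sup>2))) = (1 + \<epsilon>) * U + \<epsilon> / (1 - x\<^sup>2)"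
    proof -
      have "(1 + \<epsilon>) * k = \<epsilon>"
        using \<epsilon> by (simp add: k_def)
      then have "(1 + \<epsilon>) * (k * (1 / (1 - x\<^sup>2))) = \<epsilon> * (1 / (1 - x\<^sup>2))"
        by (simp only: mult.assoc[symmetric])
      then show ?thesis
        by (simp only: distrib_left) simp
    qed
    ultimately have "U + k * (1 / (1 - x\<^sup>2)) \<le> 0"
      using \<epsilon> by (metis add_pos_pos mult_pos_pos not_le zero_less_one)
    moreover have "((\<lambda>y. u z y + k * artanh y) has_field_derivative U + k * (1 / (1 - x\<^sup>2))) (at x)"
      using x by (intro DERIV_add U DERIV_cmult artanh_real_has_field_derivative) auto
    ultimately show "\<exists>y. ((\<lambda>y. u z y + k * artanh y) has_field_derivative y) (at x) \<and> y \<le> 0"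
      by blast
  qed
  then show ?thesis
    by (simp add: u_def k_def)
qed

section \<open>Existence, uniqueness and simplicity of the zero\<close>

text \<open>
  The radius \<open>R\<close> is prescribed by \<open>\<epsilon>\<close> and \<open>C\<close> alone and does not refer to \<open>G\<close> or \<open>z\<close>; this uniformity
  is what confines the zeros of a whole family to one compact disc.
\<close>

lemma form_factorization:
  assumes z: "z \<in> D" and \<epsilon>: "0 < \<epsilon>" and shift: "\<And>a. a \<in> unit_disc \<Longrightarrow> z + \<epsilon> *\<^sub>R (z - f a) \<in> D"
    and C: "cmod (\<Phi> z 0) \<le> C" and R: "0 \<le> R" "R < 1"
    and radius: "\<And>r. \<lbrakk>R < r; r < 1\<rbrakk> \<Longrightarrow> C < \<epsilon> / (1 + \<epsilon>) * artanh r"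
  obtains \<psi> where "corresponding_lempert f G z \<in> cball 0 R" and "\<psi> holomorphic_on unit_disc"
    and "\<And>\<zeta>. \<zeta> \<in> unit_disc \<Longrightarrow> \<psi> \<zeta> \<noteq> 0"
    and "\<And>\<zeta>. \<zeta> \<in> unit_disc \<Longrightarrow> \<Phi> z \<zeta> = (\<zeta> - corresponding_lempert f G z) * \<psi> \<zeta>"
proof -
  have inward: "Re (\<Phi> z \<zeta> * cnj \<zeta>) < 0" if \<zeta>: "R < cmod \<zeta>" "cmod \<zeta> < 1" for \<zeta>
  proof -
    define r e where "r = cmod \<zeta>" and "e = \<zeta> / of_real (cmod \<zeta>)"
    have r: "0 < r" "r < 1"
      using R \<zeta> by (auto simp: r_def)
    then have e: "cmod e = 1" and re: "\<zeta> = of_real r * e"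
      by (auto simp: r_def e_def norm_divide)
    have "Re (\<Phi> z 0 * cnj e) \<le> C"
      using C complex_Re_le_cmod[of "\<Phi> z 0 * cnj e"] e by (simp add: norm_mult)
    also have "C < \<epsilon> / (1 + \<epsilon>) * artanh r"
      using radius \<zeta> by (simp add: r_def)
    finally have "Re (\<Phi> z \<zeta> * cnj e) / (1 - r\<^sup>2) < 0"
      using radial_decay[OF z \<epsilon> shift e, of r] r by (simp add: re)
    moreover have "0 < 1 - r\<^sup>2"
      using r by (simp add: abs_square_less_1)
    ultimately have "Re (\<Phi> z \<zeta> * cnj e) < 0"
      by (simp add: divide_less_0_iff)
    moreover have "Re (\<Phi> z \<zeta> * cnj \<zeta>) = r * Re (\<Phi> z \<zeta> * cnj e)"
    proof -
      have "\<Phi> z \<zeta> * cnj \<zeta> = of_real r * (\<Phi> z \<zeta> * cnj e)"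
        by (simp add: re)
      then show ?thesis
        by (simp only: Re_of_real_mult)
    qed
    ultimately show ?thesis
      using r(1) by (simp only: mult_pos_neg)
  qed
  obtain a \<psi> where a: "cmod a \<le> R" and \<psi>: "\<psi> holomorphic_on unit_disc" "\<And>\<zeta>. \<zeta> \<in> unit_disc \<Longrightarrow> \<psi> \<zeta> \<noteq> 0"
    and fact: "\<And>\<zeta>. \<zeta> \<in> unit_disc \<Longrightarrow> \<Phi> z \<zeta> = (\<zeta> - a) * \<psi> \<zeta>"
    using inward_field_has_unique_simple_zero[OF holo_form R inward] by blast
  have "corresponding_lempert f G z = a"
    unfolding corresponding_lempert_def lempert_form_def[symmetric]
    using a R(2) \<psi>(2) fact by (intro the_equality) auto
  then show ?thesis
    using that[of \<psi>] a \<psi> fact by simp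
qed

text \<open>
  This is where \<open>D\<close> being open and bounded enters: a small multiple of \<open>z - f a\<close> is shorter
  than the distance from \<open>z\<close> to the complement of \<open>D\<close>.
\<close>

lemma uniform_shift_in_D:
  assumes "z0 \<in> D"
  obtains r \<epsilon> where "0 < r" "0 < \<epsilon>" "cball z0 r \<subseteq> D"
    "\<And>z a. \<lbrakk>z \<in> cball z0 r; a \<in> unit_disc\<rbrakk> \<Longrightarrow> z + \<epsilon> *\<^sub>R (z - f a) \<in> D"
proof -
  obtain \<rho> where \<rho>: "0 < \<rho>" "cball z0 \<rho> \<subseteq> D"
    using assms open_D open_contains_cball by blast
  obtain B where B: "0 < B" "\<And>v. v \<in> D \<Longrightarrow> norm v \<le> B"
    using bounded_D by (auto simp: bounded_pos)
  define \<epsilon> where "\<epsilon> = \<rho> / 2 / (2 * B)"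
  show ?thesis
  proof (rule that[of "\<rho> / 2" \<epsilon>])
    show "0 < \<epsilon>"
      using \<rho> B by (simp add: \<epsilon>_def)
    fix z a assume z: "z \<in> cball z0 (\<rho> / 2)" and a: "a \<in> unit_disc"
    have "z \<in> D" "f a \<in> D"
      using z a \<rho> f_in_D by (auto simp: subset_iff)
    then have "norm (z - f a) \<le> 2 * B"
      using B(2)[of z] B(2)[of "f a"] norm_triangle_ineq4[of z "f a"] by linarith
    then have "norm (\<epsilon> *\<^sub>R (z - f a)) \<le> \<epsilon> * (2 * B)"
      using \<open>0 < \<epsilon>\<close> by (simp add: mult_left_mono)
    also have "\<dots> = \<rho> / 2"
      using B by (simp add: \<epsilon>_def)
    finally have "dist z0 (z + \<epsilon> *\<^sub>R (z - f a)) \<le> \<rho> / 2 + \<rho> / 2"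
      using z dist_triangle[of z0 "z + \<epsilon> *\<^sub>R (z - f a)" z] by (simp add: dist_norm)
    then show "z + \<epsilon> *\<^sub>R (z - f a) \<in> D"
      using \<rho> by auto
  qed (use \<rho> in auto)
qed

lemma form_at_0_bounded: "\<exists>C. \<forall>z\<in>D. cmod (\<Phi> z 0) \<le> C"
proof -
  obtain K where K: "0 < K" "\<And>a b :: complex ^ 'n. cmod (scalar_product a b) \<le> norm a * norm b * K"
    using sp.pos_bounded by blast
  obtain B where B: "\<And>v. v \<in> D \<Longrightarrow> norm v \<le> B"
    using bounded_D by (auto simp: bounded_iff)
  have "cmod (\<Phi> z 0) \<le> (B + norm (f 0)) * norm (complex_gradient G (f 0)) * K" if "z \<in> D" for z
  proof -
    have "norm (z - f 0) \<le> B + norm (f 0)"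
      using B[OF that] norm_triangle_ineq4[of z "f 0"] by linarith
    then have "norm (z - f 0) * norm (complex_gradient G (f 0)) * K
        \<le> (B + norm (f 0)) * norm (complex_gradient G (f 0)) * K"
      using K(1) by (intro mult_right_mono) auto
    with K(2) show ?thesis
      unfolding lempert_form_def by (rule order_trans)
  qed
  then show ?thesis
    by blast
qed

lemma form_factorization_at:
  assumes "z \<in> D"
  obtains \<psi> where "corresponding_lempert f G z \<in> unit_disc" and "\<psi> holomorphic_on unit_disc"
    and "\<And>\<zeta>. \<zeta> \<in> unit_disc \<Longrightarrow> \<psi> \<zeta> \<noteq> 0"
    and "\<And>\<zeta>. \<zeta> \<in> unit_disc \<Longrightarrow> \<Phi> z \<zeta> = (\<zeta> - corresponding_lempert f G z) * \<psi> \<zeta>"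
proof -
  obtain r \<epsilon> where \<epsilon>: "0 < r" "0 < \<epsilon>"
    and shift: "\<And>w a. \<lbrakk>w \<in> cball z r; a \<in> unit_disc\<rbrakk> \<Longrightarrow> w + \<epsilon> *\<^sub>R (w - f a) \<in> D"
    using uniform_shift_in_D[OF assms] by metis
  have k: "0 < \<epsilon> / (1 + \<epsilon>)"
    using \<epsilon> by simp
  obtain R where R: "0 \<le> R" "R < 1" "\<And>r. \<lbrakk>R < r; r < 1\<rbrakk> \<Longrightarrow> cmod (\<Phi> z 0) < \<epsilon> / (1 + \<epsilon>) * artanh r"
    using artanh_eventually_large[OF k] by metis
  have "z \<in> cball z r"
    using \<epsilon> by simp
  from form_factorization[OF assms \<epsilon>(2) shift[OF this] order_refl R] R(2) that show ?thesis
    by (smt (verit) mem_ball_0 mem_cball_0)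
qed

lemma corresponding_lempert_in_disc: "z \<in> D \<Longrightarrow> corresponding_lempert f G z \<in> unit_disc"
  using form_factorization_at by metis

lemma form_zero_iff:
  "\<lbrakk>z \<in> D; \<zeta> \<in> unit_disc\<rbrakk> \<Longrightarrow> \<Phi> z \<zeta> = 0 \<longleftrightarrow> corresponding_lempert f G z = \<zeta>"
  using form_factorization_at[of z] by (metis eq_iff_diff_eq_0 mult_eq_0_iff)

section \<open>Holomorphy and fibers of the Lempert left inverse\<close>

text \<open>
  Let \<open>H\<close> be the Lempert left inverse. As \<open>\<Phi>\<close> is affine in \<open>z\<close>, the equation \<open>\<Phi> z (H z) = 0\<close> reads
  \<open>(H z - H z0) * \<psi> (H z) = - (z - z0) \<bullet> h (H z)\<close>, with \<open>\<bullet>\<close> the bilinear product, \<open>h\<close> the gradient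
  along \<open>f\<close>, and \<open>\<psi>\<close> the nonvanishing cofactor of the simple zero of \<open>\<Phi> z0\<close>. Dividing by \<open>\<psi> (H z)\<close>
  exhibits a continuous slope.
\<close>

lemma holomorphic_corresponding_lempert:
  assumes cont: "continuous_on D (corresponding_lempert f G)"
  shows "holomorphic_fun_on (corresponding_lempert f G) D"
  unfolding holomorphic_fun_on_def
proof
  fix z0 assume z0: "z0 \<in> D"
  let ?H = "corresponding_lempert f G"
  obtain \<psi> where \<psi>: "\<psi> holomorphic_on unit_disc" "\<And>\<zeta>. \<zeta> \<in> unit_disc \<Longrightarrow> \<psi> \<zeta> \<noteq> 0"
    and fact: "\<And>\<zeta>. \<zeta> \<in> unit_disc \<Longrightarrow> \<Phi> z0 \<zeta> = (\<zeta> - ?H z0) * \<psi> \<zeta>"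
    using form_factorization_at[OF z0] by metis
  define \<kappa> where "\<kappa> \<zeta> = (- 1 / \<psi> \<zeta>) *s complex_gradient G (f \<zeta>)" for \<zeta>
  have "holomorphic_curve_on \<kappa> unit_disc"
    using holo_gradient \<psi> unfolding \<kappa>_def holomorphic_curve_on_def
    by (auto intro!: holomorphic_intros)
  then have "continuous_on D (\<lambda>z. \<kappa> (?H z))"
    by (intro continuous_on_compose2[OF continuous_on_holomorphic_curve cont])
      (use corresponding_lempert_in_disc in auto)
  then have cont_slope: "isCont (\<lambda>z. \<kappa> (?H z)) z0"
    using open_D z0 by (simp add: continuous_on_eq_continuous_at)
  have "(?H has_derivative scalar_product (\<kappa> (?H z0))) (at z0)"
  proof (rule has_derivative_of_slope[OF open_D z0 _ cont_slope])
    fix z assume z: "z \<in> D"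
    let ?a = "?H z"
    have a: "?a \<in> unit_disc"
      by (rule corresponding_lempert_in_disc[OF z])
    have "\<Phi> z ?a = \<Phi> z0 ?a + scalar_product (z - z0) (complex_gradient G (f ?a))"
      by (simp add: lempert_form_def sp.diff_left)
    moreover have "\<Phi> z ?a = 0"
      using form_zero_iff[OF z a] by simp
    ultimately have "(?a - ?H z0) * \<psi> ?a = - scalar_product (complex_gradient G (f ?a)) (z - z0)"
      using fact[OF a] by (simp add: scalar_product_commute add_eq_0_iff2)
    then have "?a - ?H z0 = - 1 / \<psi> ?a * scalar_product (complex_gradient G (f ?a)) (z - z0)"
      using \<psi>(2)[OF a] by (simp add: field_simps)
    then show "?a - ?H z0 = scalar_product (\<kappa> ?a) (z - z0)"
      by (simp only: \<kappa>_def scalar_product_commute[of _ "z - z0"] scalar_product_smult)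
  qed
  then show "\<exists>a. (?H has_derivative scalar_product a) (at z0)" ..
qed

lemma lempert_left_inverse_corresponding:
  assumes "continuous_on D (corresponding_lempert f G)"
  shows "lempert_left_inverse D f (corresponding_lempert f G)"
  unfolding lempert_left_inverse_def left_inverse_def
proof (intro conjI ballI)
  show "holomorphic_fun_on (corresponding_lempert f G) D"
    by (rule holomorphic_corresponding_lempert[OF assms])
  show "corresponding_lempert f G ` D \<subseteq> unit_disc"
    using corresponding_lempert_in_disc by blast
  show "corresponding_lempert f G (f \<zeta>) = \<zeta>" if "\<zeta> \<in> unit_disc" for \<zeta>
    using form_zero_iff[of "f \<zeta>" \<zeta>] form_at_disc_point that f_in_D by blast
  fix \<zeta> assume \<zeta>: "\<zeta> \<in> unit_disc"
  let ?h = "complex_gradient G (f \<zeta>)"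
  show "\<exists>P. complex_affine_hyperplane P \<and> {z \<in> D. corresponding_lempert f G z = \<zeta>} = D \<inter> P"
  proof (intro exI conjI)
    show "complex_affine_hyperplane {z. scalar_product ?h z = scalar_product ?h (f \<zeta>)}"
      unfolding complex_affine_hyperplane_def using gradient_nonzero[OF \<zeta>] by blast
    have "\<Phi> z \<zeta> = 0 \<longleftrightarrow> scalar_product ?h z = scalar_product ?h (f \<zeta>)" for z
      by (simp add: lempert_form_def sp.diff_left scalar_product_commute[of ?h])
    then show "{z \<in> D. corresponding_lempert f G z = \<zeta>}
        = D \<inter> {z. scalar_product ?h z = scalar_product ?h (f \<zeta>)}"
      using form_zero_iff[OF _ \<zeta>] by blast
  qed
qed

end

section \<open>The family joining two Lempert left inverses\<close>

locale two_left_inverses =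
  L0: geodesic_with_left_inverse D f G0 + L1: geodesic_with_left_inverse D f G1
  for D :: "(complex ^ 'n) set" and f G0 G1
begin

definition pencil :: "real \<Rightarrow> complex ^ 'n \<Rightarrow> complex" where
  "pencil t z = (1 - t) *\<^sub>R G0 z + t *\<^sub>R G1 z"

lemma pencil_has_derivative:
  assumes "z \<in> D"
  shows "(pencil t has_derivative
    scalar_product ((1 - t) *\<^sub>R complex_gradient G0 z + t *\<^sub>R complex_gradient G1 z)) (at z)"
proof -
  have "((\<lambda>z. (1 - t) *\<^sub>R G0 z + t *\<^sub>R G1 z) has_derivative
      (\<lambda>v. (1 - t) *\<^sub>R scalar_product (complex_gradient G0 z) v
        + t *\<^sub>R scalar_product (complex_gradient G1 z) v)) (at z)"
    by (intro has_derivative_add has_derivative_scaleR_right 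
        has_derivative_complex_gradient[OF L0.holo_G assms]
        has_derivative_complex_gradient[OF L1.holo_G assms])
  then show ?thesis
    unfolding pencil_def[abs_def]
    by (rule has_derivative_eq_rhs) (simp add: fun_eq_iff sp.add_left sp.scaleR_left)
qed

lemma pencil_is_left_inverse:
  assumes "t \<in> {0..1}"
  shows "geodesic_with_left_inverse D f (pencil t)"
proof unfold_locales
  have "holomorphic_fun_on (pencil t) D"
    unfolding holomorphic_fun_on_def using pencil_has_derivative by blast
  moreover have "pencil t z \<in> unit_disc" if "z \<in> D" for z
    unfolding pencil_def using that L0.G_in_disc L1.G_in_disc assms
    by (intro convexD_alt[OF convex_ball]) auto
  moreover have "pencil t (f \<zeta>) = \<zeta>" if "\<zeta> \<in> unit_disc" for \<zeta>
    using L0.G_f[OF that] L1.G_f[OF that] by (simp add: pencil_def flip: scaleR_add_left)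
  ultimately show "left_inverse D f (pencil t)"
    by (auto simp: left_inverse_def)
qed (rule L0.open_D L0.bounded_D L0.convex_D L0.holo_f L0.f_in_D)+

lemma form_pencil:
  assumes "\<zeta> \<in> unit_disc"
  shows "lempert_form f (pencil t) z \<zeta> = (1 - t) *\<^sub>R lempert_form f G0 z \<zeta> + t *\<^sub>R lempert_form f G1 z \<zeta>"
proof -
  have "f \<zeta> \<in> D"
    using assms L0.f_in_D by blast
  from complex_gradient_eq[OF pencil_has_derivative[OF this]] show ?thesis
    by (simp add: lempert_form_def sp.add_right sp.scaleR_right)
qed

lemma continuous_form:
  assumes "geodesic_with_left_inverse D f G"
  shows "continuous_on (UNIV \<times> unit_disc) (\<lambda>(z, \<zeta>). lempert_form f G z \<zeta>)"
proof -
  interpret geodesic_with_left_inverse D f G by fact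
  show ?thesis
    unfolding lempert_form_def split_def
    by (intro sp.continuous_on continuous_on_diff continuous_on_fst continuous_on_id
        continuous_on_compose2[OF continuous_on_holomorphic_curve[OF holo_f] continuous_on_snd[OF continuous_on_id]]
        continuous_on_compose2[OF continuous_on_holomorphic_curve[OF holo_gradient] continuous_on_snd[OF continuous_on_id]])
      auto
qed

text \<open>
  The shift \<open>\<epsilon>\<close> depends on \<open>D\<close> and \<open>f\<close> only, and the forms of the convex combinations at \<open>0\<close> are bounded by
  the larger of the bounds at the two ends; hence one radius serves all \<open>t\<close>.
\<close>

lemma lempert_family_uniformly_inside:
  assumes "z0 \<in> D"
  obtains r R where "0 < r" "cball z0 r \<subseteq> D" "R < 1"
    and "\<And>t z. \<lbrakk>t \<in> {0..1}; z \<in> cball z0 r\<rbrakk> \<Longrightarrow> corresponding_lempert f (pencil t) z \<in> cball 0 R"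
proof -
  obtain r \<epsilon> where r: "0 < r" "0 < \<epsilon>" "cball z0 r \<subseteq> D"
    and shift: "\<And>z a. \<lbrakk>z \<in> cball z0 r; a \<in> unit_disc\<rbrakk> \<Longrightarrow> z + \<epsilon> *\<^sub>R (z - f a) \<in> D"
    using L0.uniform_shift_in_D[OF assms] by metis
  obtain C0 C1 where C: "\<And>z. z \<in> D \<Longrightarrow> cmod (lempert_form f G0 z 0) \<le> C0"
    "\<And>z. z \<in> D \<Longrightarrow> cmod (lempert_form f G1 z 0) \<le> C1"
    using L0.form_at_0_bounded L1.form_at_0_bounded by metis
  define C where "C = max C0 C1"
  have bound: "cmod (lempert_form f (pencil t) z 0) \<le> C" if "t \<in> {0..1}" "z \<in> D" for t z
  proof -
    have "lempert_form f (pencil t) z 0 \<in> cball 0 C"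
      using that C by (simp only: form_pencil centre_in_ball zero_less_one, intro convexD_alt[OF convex_cball])
        (auto simp: C_def le_max_iff_disj)
    then show ?thesis
      by simp
  qed
  have k: "0 < \<epsilon> / (1 + \<epsilon>)"
    using r by simp
  obtain R where R: "0 \<le> R" "R < 1" "\<And>r. \<lbrakk>R < r; r < 1\<rbrakk> \<Longrightarrow> C < \<epsilon> / (1 + \<epsilon>) * artanh r"
    using artanh_eventually_large[OF k] by metis
  show ?thesis
  proof (rule that[OF r(1,3) R(2)])
    fix t z assume t: "t \<in> {0..1 :: real}" and z: "z \<in> cball z0 r"
    interpret geodesic_with_left_inverse D f "pencil t"
      by (rule pencil_is_left_inverse[OF t])
    have "z \<in> D"
      using z r by blast
    from form_factorization[OF this r(2) shift[OF z] bound[OF t this] R]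
    show "corresponding_lempert f (pencil t) z \<in> cball 0 R"
      by blast
  qed
qed

text \<open>
  The graph of the family over a compact neighbourhood is the zero set of a continuous function of
  \<open>(t, z, \<zeta>)\<close>, where \<open>\<zeta>\<close> ranges over a compact disc. A function with closed graph and compact range
  is continuous.
\<close>

lemma continuous_lempert_family:
  "continuous_on ({0..1} \<times> D) (\<lambda>(t, z). corresponding_lempert f (pencil t) z)"
proof (subst continuous_on_eq_continuous_within, intro ballI)
  let ?H = "\<lambda>(t, z). corresponding_lempert f (pencil t) z"
  fix p assume "p \<in> {0..1 :: real} \<times> D"
  then obtain t0 z0 where p: "p = (t0, z0)" "t0 \<in> {0..1}" "z0 \<in> D"
    by blast
  obtain r R where r: "0 < r" "cball z0 r \<subseteq> D" and R: "R < 1"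
    and inside: "\<And>t z. \<lbrakk>t \<in> {0..1}; z \<in> cball z0 r\<rbrakk> \<Longrightarrow> corresponding_lempert f (pencil t) z \<in> cball 0 R"
    using lempert_family_uniformly_inside[OF p(3)] by metis
  define S where "S = {0..1 :: real} \<times> cball z0 r"
  have disc: "cball 0 R \<subseteq> unit_disc"
    using R by auto
  have "continuous_on S ?H"
  proof (rule continuous_from_closed_graph)
    show "compact (cball (0 :: complex) R)"
      by simp
    show "?H \<in> S \<rightarrow> cball 0 R"
      using inside by (auto simp: S_def)
    define \<Psi> where "\<Psi> = (\<lambda>((t, z), \<zeta>). (1 - t) *\<^sub>R lempert_form f G0 z \<zeta> + t *\<^sub>R lempert_form f G1 z \<zeta>)"
    have "(\<lambda>p. (p, ?H p)) ` S = {q \<in> S \<times> cball 0 R. \<Psi> q = 0}"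
    proof (intro equalityI subsetI)
      fix q assume "q \<in> (\<lambda>p. (p, ?H p)) ` S"
      then obtain t z where q: "q = ((t, z), corresponding_lempert f (pencil t) z)" "t \<in> {0..1}" "z \<in> cball z0 r"
        by (auto simp: S_def)
      interpret geodesic_with_left_inverse D f "pencil t"
        by (rule pencil_is_left_inverse[OF q(2)])
      have "z \<in> D"
        using q(3) r by blast
      then have "lempert_form f (pencil t) z (corresponding_lempert f (pencil t) z) = 0"
        using form_zero_iff corresponding_lempert_in_disc by blast
      then show "q \<in> {q \<in> S \<times> cball 0 R. \<Psi> q = 0}"
        using q inside[OF q(2,3)] form_pencil corresponding_lempert_in_disc[OF \<open>z \<in> D\<close>]
        by (auto simp: S_def \<Psi>_def)
    next
      fix q assume "q \<in> {q \<in> S \<times> cball 0 R. \<Psi> q = 0}"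
      then obtain t z \<zeta> where q: "q = ((t, z), \<zeta>)" "t \<in> {0..1}" "z \<in> cball z0 r" "\<zeta> \<in> cball 0 R" "\<Psi> q = 0"
        by (auto simp: S_def)
      interpret geodesic_with_left_inverse D f "pencil t"
        by (rule pencil_is_left_inverse[OF q(2)])
      have "z \<in> D" "\<zeta> \<in> unit_disc"
        using q(3,4) r disc by blast+
      then have "corresponding_lempert f (pencil t) z = \<zeta>"
        using q(5) form_pencil form_zero_iff by (auto simp: q(1) \<Psi>_def)
      then show "q \<in> (\<lambda>p. (p, ?H p)) ` S"
        using q by (auto simp: S_def image_iff)
    qed
    moreover have "closed {q \<in> S \<times> cball 0 R. \<Psi> q = 0}"
    proof -
      have "continuous_on (S \<times> cball 0 R) (\<lambda>q. lempert_form f G (snd (fst q)) (snd q))"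
        if "geodesic_with_left_inverse D f G" for G
      proof -
        have "continuous_on (S \<times> cball 0 R) (\<lambda>q. (snd (fst q), snd q))"
          by (intro continuous_intros)
        moreover have "(\<lambda>q. (snd (fst q), snd q)) ` (S \<times> cball 0 R) \<subseteq> UNIV \<times> unit_disc"
          using disc by auto
        ultimately show ?thesis
          using continuous_on_compose2[OF continuous_form[OF that]] by fastforce
      qed
      from this[OF L0.geodesic_with_left_inverse_axioms] this[OF L1.geodesic_with_left_inverse_axioms]
      have "continuous_on (S \<times> cball 0 R) \<Psi>"
        unfolding \<Psi>_def split_def by (intro continuous_intros)
      moreover have "closed (S \<times> cball (0 :: complex) R)"
        by (intro closed_Times) (auto simp: S_def closed_Times)
      ultimately show ?thesis
        by (rule continuous_closed_preimage_constant)
    qed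
    ultimately show "closed ((\<lambda>p. (p, ?H p)) ` S)"
      by simp
  qed
  then have "continuous (at p within S) ?H"
    using p r by (auto simp: continuous_on_eq_continuous_within S_def)
  moreover have "at p within S = at p within ({0..1} \<times> D)"
  proof (rule at_within_nhd)
    show "p \<in> UNIV \<times> ball z0 r" "open (UNIV \<times> ball z0 r :: (real \<times> (complex ^ 'n)) set)"
      using p r by (auto intro: open_Times)
    show "S \<inter> (UNIV \<times> ball z0 r) - {p} = {0..1} \<times> D \<inter> (UNIV \<times> ball z0 r) - {p}"
      using r by (auto simp: S_def subset_iff)
  qed
  ultimately show "continuous (at p within {0..1} \<times> D) ?H"
    by simp
qed

lemma lempert_family_is_lempert:
  assumes t: "t \<in> {0..1}"
  shows "lempert_left_inverse D f (corresponding_lempert f (pencil t))"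
proof -
  interpret geodesic_with_left_inverse D f "pencil t"
    by (rule pencil_is_left_inverse[OF t])
  have "continuous_on D (corresponding_lempert f (pencil t))"
    using t by (intro continuous_on_compose2[OF continuous_lempert_family, of D "\<lambda>z. (t, z)", simplified])
      (auto intro!: continuous_intros)
  then show ?thesis
    by (rule lempert_left_inverse_corresponding)
qed

end

theorem theorem2p3:
  fixes D :: "(complex ^ 'n) set"
    and f :: "complex \<Rightarrow> complex ^ 'n"
    and G0 G1 H0 H1 :: "complex ^ 'n \<Rightarrow> complex"
  assumes "open D" and "bounded D" and "convex D"
    and "complex_geodesic D f"
    and "left_inverse D f G0" and "left_inverse D f G1"
    and "\<forall>z\<in>D. H0 z = corresponding_lempert f G0 z"
    and "\<forall>z\<in>D. H1 z = corresponding_lempert f G1 z"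
  shows "\<exists>H :: real \<Rightarrow> complex ^ 'n \<Rightarrow> complex.
           (\<forall>t\<in>{0..1}. lempert_left_inverse D f (H t)) \<and>
           continuous_on ({0..1} \<times> D) (\<lambda>(t, z). H t z) \<and>
           (\<forall>z\<in>D. H 0 z = H0 z) \<and> (\<forall>z\<in>D. H 1 z = H1 z)"
proof -
  interpret two_left_inverses D f G0 G1
    using assms by unfold_locales (auto simp: complex_geodesic_def)
  have "pencil 0 = G0" "pencil 1 = G1"
    by (simp_all add: pencil_def fun_eq_iff)
  then show ?thesis
    using assms(7,8) lempert_family_is_lempert continuous_lempert_family
    by (intro exI[of _ "\<lambda>t. corresponding_lempert f (pencil t)"]) simp
qed

end
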